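(* The maximal number of real intersection points of a real line with a real plane curve defined by a polynomial with three non-zero terms, when this number is finite, is eleven. That is: (i) for every polynomial $f \in \mathbb{R}[x,y]$ with exactly three non-zero terms and every line $L \subset \mathbb{R}^2$, if the set $\{(x,y) \in L : f(x,y)=0\}$ is finite, then it has at most eleven elements; and (ii) there exist a polynomial $f \in \mathbb{R}[x,y]$ with exactly three non-zero terms and a line $L \subset \mathbb{R}^2$ such that the set $\{(x,y)\in L : f(x,y)=0\}$ has exactly eleven elements.
   Context: The number of non-zero terms of a polynomial is the number of monomials $x^i y^j$ (with $i,j$ nonnegative integers) appearing in it with a non-zero coefficient. Intersection points are points of $\mathbb{R}^2$; a line is any affine line in $\mathbb{R}^2$. *)

theory Defs
  imports "HOL-Analysis.Analysis" "HOL-Computational_Algebra.Polynomial"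
begin

text \<open>
  An element of \<open>\<real>[x,y]\<close> is represented as a polynomial in \<open>y\<close> with coefficients in \<open>\<real>[x]\<close>,
  so the coefficient of \<open>x\<^sup>i y\<^sup>j\<close> in \<open>f\<close> is \<open>coeff (coeff f j) i\<close>.
\<close>

definition monomials2 :: "'a::zero poly poly \<Rightarrow> (nat \<times> nat) set" where
  "monomials2 f = {(i, j). coeff (coeff f j) i \<noteq> 0}"

definition num_terms2 :: "'a::zero poly poly \<Rightarrow> nat" where
  "num_terms2 f = card (monomials2 f)"

definition eval2 :: "'a::comm_semiring_0 poly poly \<Rightarrow> 'a \<Rightarrow> 'a \<Rightarrow> 'a" where
  "eval2 f x y = poly (poly f [:y:]) x"

definition real_curve :: "real poly poly \<Rightarrow> (real \<times> real) set" where
  "real_curve f = {(x, y). eval2 f x y = 0}"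

definition is_line :: "(real \<times> real) set \<Rightarrow> bool" where
  "is_line L \<longleftrightarrow> affine L \<and> aff_dim L = 1"

lemma finite_monomials2: "finite (monomials2 f)"
proof (rule finite_subset)
  show "monomials2 f \<subseteq> (\<lambda>(j, i). (i, j)) ` Sigma {..degree f} (\<lambda>j. {..degree (coeff f j)})"
  proof
    fix p assume "p \<in> monomials2 f"
    then obtain i j where p: "p = (i, j)" and nz: "coeff (coeff f j) i \<noteq> 0"
      by (auto simp: monomials2_def)
    then have "coeff f j \<noteq> 0" by (metis coeff_0)
    with nz have "(j, i) \<in> Sigma {..degree f} (\<lambda>j. {..degree (coeff f j)})"
      by (simp add: le_degree)
    then show "p \<in> (\<lambda>(j, i). (i, j)) ` Sigma {..degree f} (\<lambda>j. {..degree (coeff f j)})"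
      unfolding p by (rule rev_image_eqI) simp
  qed
qed simp

lemma eval2_eq_sum_monomials2:
  fixes f :: "'a::comm_semiring_1 poly poly"
  shows "eval2 f x y = (\<Sum>(i, j)\<in>monomials2 f. coeff (coeff f j) i * x ^ i * y ^ j)"
proof -
  let ?t = "\<lambda>i j. coeff (coeff f j) i * x ^ i * y ^ j"
  let ?S = "Sigma {..degree f} (\<lambda>j. {..degree (coeff f j)})"
  have pow: "[:y:] ^ j = [:y ^ j:]" for j
    by (induction j) (simp_all add: one_pCons mult.commute)
  have "eval2 f x y = (\<Sum>j\<le>degree f. \<Sum>i\<le>degree (coeff f j). ?t i j)"
    by (simp add: eval2_def poly_altdef[of f] poly_sum pow poly_altdef[of "coeff f _"] sum_distrib_right
        sum_distrib_left ac_simps)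
  also have "\<dots> = (\<Sum>(j, i)\<in>?S. ?t i j)"
    by (simp add: sum.Sigma)
  also have "\<dots> = (\<Sum>(j, i)\<in>{p \<in> ?S. coeff (coeff f (fst p)) (snd p) \<noteq> 0}. ?t i j)"
    by (rule sum.mono_neutral_right) auto
  also have "\<dots> = (\<Sum>(i, j)\<in>monomials2 f. ?t i j)"
  proof (rule sum.reindex_bij_witness[where i = prod.swap and j = prod.swap])
    fix p assume p: "p \<in> monomials2 f"
    then have nz: "coeff (coeff f (snd p)) (fst p) \<noteq> 0"
      by (auto simp: monomials2_def)
    then have "coeff f (snd p) \<noteq> 0" by (metis coeff_0)
    with nz show "prod.swap p \<in> {p \<in> ?S. coeff (coeff f (fst p)) (snd p) \<noteq> 0}"
      by (simp add: prod.swap_def le_degree)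
  qed (auto simp: monomials2_def)
  finally show ?thesis .
qed

end

theory Submission imports Defs begin

text \<open>
  A line in general position can be brought to the form \<open>y = 1 + x\<close>. The points \<open>0\<close> and \<open>-1\<close>
  cut it into three intervals, and a projective change of coordinates carries each of them to
  \<open>0 < t\<close> and the restriction of the trinomial to \<open>\<Sum> c\<^sub>i t^a\<^sub>i (1 + t)^b\<^sub>i\<close>, where the pair \<open>(a, b)\<close>
  consists of two of the three homogeneous exponents \<open>\<alpha>, \<beta>, \<gamma> = d - \<alpha> - \<beta>\<close>. Descartes' rule of signs
  gives at most four roots on each interval, because multiplication by \<open>1 + t\<close> does not create sign
  variations. Four roots on one interval force one of the terms to have the smallest
  exponent in both other directions, and then the two other intervals carry at most \<open>3 + 2\<close> roots.
  This leaves at most nine roots besides \<open>0\<close> and \<open>-1\<close>.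
\<close>

section \<open>Descartes' rule of signs\<close>

text \<open>Rolle's theorem puts a zero of \<open>f'\<close> strictly between consecutive zeros of
  \<open>f\<close>. Finite sets of zeros are counted first, so that finiteness of the whole zero set
  is a consequence and not an assumption.\<close>

lemma card_roots_le_Suc_card_roots_deriv:
  fixes f f' :: "real \<Rightarrow> real"
  assumes deriv: "\<And>x. 0 < x \<Longrightarrow> (f has_real_derivative f' x) (at x)"
    and fin: "finite {x. 0 < x \<and> f' x = 0}"
  shows "finite {x. 0 < x \<and> f x = 0} \<and>
    card {x. 0 < x \<and> f x = 0} \<le> Suc (card {x. 0 < x \<and> f' x = 0})"
proof -
  have rolle: "\<exists>z. x < z \<and> z < y \<and> f' z = 0"
    if xy: "0 < x" "x < y" "f x = 0" "f y = 0" for x y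
  proof -
    have "continuous_on {x..y} f"
      using xy(1) by (intro DERIV_continuous_on[OF has_field_derivative_at_within[OF deriv]]) simp
    moreover have "(f has_derivative (*) (f' z)) (at z)" if "x < z" for z
      using deriv[of z] \<open>0 < x\<close> that by (simp add: has_field_derivative_def)
    ultimately obtain z where z: "x < z" "z < y" "(*) (f' z) = (\<lambda>v. 0)"
      using Rolle_deriv[OF xy(2), of f "\<lambda>z. (*) (f' z)"] xy(3,4) by metis
    have "f' z = 0" using fun_cong[OF z(3), of 1] by simp
    then show ?thesis using z(1,2) by blast
  qed
  \<comment> \<open>Zeros of \<open>f'\<close> are counted only between \<open>Min S\<close> and
    \<open>Max S\<close>: when the largest element is removed in the induction, the zero that
    Rolle's theorem gives below it lies outside the smaller range, so it is new.\<close>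
  have main: "card S \<le> Suc (card {z. Min S < z \<and> z < Max S \<and> f' z = 0})"
    if "finite S" "S \<noteq> {}" "\<forall>x\<in>S. 0 < x \<and> f x = 0" for S
    using that
  proof (induction "card S" arbitrary: S)
    case 0 then show ?case by simp
  next
    case (Suc n)
    define M where "M = Max S"
    define S' where "S' = S - {M}"
    have M: "M \<in> S" using Suc.prems(1,2) by (simp add: M_def)
    show ?case
    proof (cases "S' = {}")
      case True
      then have "S = {M}" using M by (auto simp: S'_def)
      then show ?thesis by simp
    next
      case False
      have S': "finite S'" "card S' = n" "insert M S' = S" "M \<notin> S'"
        using Suc.prems(1) Suc.hyps(2)[symmetric] M by (auto simp: S'_def)
      have IH: "card S' \<le> Suc (card {z. Min S' < z \<and> z < Max S' \<and> f' z = 0})"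
        using Suc.prems(3) by (intro Suc.hyps(1) S'(1) False S'(2)[symmetric]) (simp add: S'_def)
      have mem: "Max S' \<in> S'" "Min S' \<in> S'" using S' False by auto
      have lt: "Max S' < M"
        using mem Suc.prems(1) unfolding M_def S'_def by (metis Diff_iff Max_ge insertI1 order_le_less)
      have Min: "Min S \<le> Min S'" using mem(2) Suc.prems(1) by (simp add: S'_def)
      obtain z where z: "Max S' < z" "z < M" "f' z = 0"
        using rolle[of "Max S'" M] lt mem M Suc.prems(3) S' by blast
      let ?Z = "\<lambda>a b. {z. a < z \<and> z < b \<and> f' z = 0}"
      have pos: "0 < Min S" using Suc.prems(3) Min_in[OF Suc.prems(1,2)] by blast
      have fin': "finite (?Z (Min S) M)" using pos by (auto intro!: finite_subset[OF _ fin])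
      have le: "Min S' \<le> Max S'" using mem S' by auto
      have "insert z (?Z (Min S') (Max S')) \<subseteq> ?Z (Min S) M"
        using z Min lt le by auto
      then have "card (insert z (?Z (Min S') (Max S'))) \<le> card (?Z (Min S) M)"
        using fin' card_mono by blast
      moreover have "finite (?Z (Min S') (Max S'))"
        using pos Min by (auto intro!: finite_subset[OF _ fin])
      ultimately have "Suc (card (?Z (Min S') (Max S'))) \<le> card (?Z (Min S) M)"
        using z by simp
      then show ?thesis using IH S' Suc.hyps(2) by (simp add: M_def)
    qed
  qed
  have bound: "card S \<le> Suc (card {x. 0 < x \<and> f' x = 0})"
    if "finite S" "S \<subseteq> {x. 0 < x \<and> f x = 0}" for S
  proof (cases "S = {}")
    case False
    then have "0 < Min S" using that(2) Min_in[OF that(1)] by blast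
    then have "{z. Min S < z \<and> z < Max S \<and> f' z = 0} \<subseteq> {x. 0 < x \<and> f' x = 0}"
      by (simp add: subset_iff)
    then have "card {z. Min S < z \<and> z < Max S \<and> f' z = 0} \<le> card {x. 0 < x \<and> f' x = 0}"
      by (rule card_mono[OF fin])
    moreover have "card S \<le> Suc (card {z. Min S < z \<and> z < Max S \<and> f' z = 0})"
      using that(2) by (intro main[OF that(1) False]) blast
    ultimately show ?thesis by linarith
  qed simp
  have fin': "finite {x. 0 < x \<and> f x = 0}"
  proof (rule ccontr)
    assume "infinite {x. 0 < x \<and> f x = 0}"
    then obtain S where "S \<subseteq> {x. 0 < x \<and> f x = 0}" "finite S"
      "card S = Suc (Suc (card {x. 0 < x \<and> f' x = 0}))"
      using infinite_arbitrarily_large by blast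
    then show False using bound[of S] by simp
  qed
  show ?thesis using fin' bound[OF fin' subset_refl] by (rule conjI)
qed

text \<open>
  The coefficient sequence splits into \<open>n + 1\<close> consecutive (possibly empty) blocks with weakly
  alternating signs: \<open>s k\<close> numbers the block of the \<open>k\<close>-th coefficient and its parity is the sign.
  The offset \<open>m\<close> fixes the sign of the first block.
\<close>

definition sign_var_le :: "nat \<Rightarrow> real poly \<Rightarrow> bool" where
  "sign_var_le n p \<longleftrightarrow> (\<exists>s m. mono s \<and> (\<forall>k. m \<le> s k \<and> s k \<le> m + n) \<and>
     (\<forall>k. 0 \<le> (-1) ^ s k * coeff p k))"

lemma sign_var_leI:
  assumes "mono s" "\<And>k. m \<le> s k \<and> s k \<le> m + n" "\<And>k. 0 \<le> (-1) ^ s k * coeff p k"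
  shows "sign_var_le n p"
  using assms unfolding sign_var_le_def by blast

lemma sign_var_leE:
  assumes "sign_var_le n p"
  obtains s m where "mono s" "\<And>k. m \<le> s k" "\<And>k. s k \<le> m + n"
    "\<And>k. 0 \<le> (-1) ^ s k * coeff p k"
  using assms unfolding sign_var_le_def by blast

section \<open>Operations that control the number of sign variations\<close>

lemma sign_var_le_monom: "sign_var_le 0 (monom c a)"
  by (rule sign_var_leI[of "\<lambda>_. if 0 \<le> c then 0 else 1" "if 0 \<le> c then 0 else 1"])
    (auto simp: mono_def)

text \<open>The new \<open>k\<close>-th coefficient is the sum of the old ones at \<open>k\<close>
  and \<open>k - 1\<close>. If its sign disagrees with block \<open>s k\<close>, the blocks
  \<open>s k\<close> and \<open>s (k - 1)\<close> have opposite parity and the sign agrees with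
  \<open>s (k - 1)\<close>. The chosen numbers interlace with \<open>s\<close>, so they stay
  monotone and in the same range.\<close>

lemma sign_var_le_linear_mult:
  assumes "sign_var_le n p"
  shows "sign_var_le n ([:1, 1:] * p)"
proof -
  obtain s m where s: "mono s" "\<And>k. m \<le> s k" "\<And>k. s k \<le> m + n"
    "\<And>k. 0 \<le> (-1) ^ s k * coeff p k"
    using assms by (rule sign_var_leE) blast
  let ?q = "[:1, 1:] * p"
  define s' where "s' k = (if 0 \<le> (-1) ^ s k * coeff ?q k then s k else s (k - 1))" for k
  have co: "coeff ?q k = coeff p k + (if k = 0 then 0 else coeff p (k - 1))" for k
    by (cases k) (auto simp: coeff_pCons)
  have le: "s (k - 1) \<le> s' k" "s' k \<le> s k" for k
    using monoD[OF s(1), of "k - 1" k] by (auto simp: s'_def)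
  show ?thesis
  proof (rule sign_var_leI)
    show "mono s'"
      unfolding mono_iff_le_Suc
    proof
      show "s' k \<le> s' (Suc k)" for k using le(2)[of k] le(1)[of "Suc k"] by simp
    qed
    show "m \<le> s' k \<and> s' k \<le> m + n" for k using s by (auto simp: s'_def)
    show "0 \<le> (-1) ^ s' k * coeff ?q k" for k
    proof (cases "0 \<le> (-1) ^ s k * coeff ?q k")
      case False
      then have eq: "s' k = s (k - 1)" by (simp add: s'_def)
      show ?thesis
        unfolding eq using False s(4)[of k] s(4)[of "k - 1"] unfolding co
        by (cases "even (s k)"; cases "even (s (k - 1))") (auto split: if_splits)
    qed (simp add: s'_def)
  qed
qed

lemma sign_var_le_linear_power_mult:
  "sign_var_le n p \<Longrightarrow> sign_var_le n ([:1, 1:] ^ r * p)"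
proof (induction r)
  case (Suc r)
  then show ?case using sign_var_le_linear_mult[of n "[:1, 1:] ^ r * p"] by (simp only: power_Suc mult.assoc)
qed simp

text \<open>Only the coefficient at \<open>j\<close> changes. It may need a block of its own, and
  the later blocks move up by two, which preserves their parity.\<close>

lemma sign_var_le_add_monom:
  assumes "sign_var_le n p"
  shows "sign_var_le (n + 2) (p + monom c j)"
proof -
  obtain s m where s: "mono s" "\<And>k. m \<le> s k" "\<And>k. s k \<le> m + n"
    "\<And>k. 0 \<le> (-1) ^ s k * coeff p k"
    using assms by (rule sign_var_leE) blast
  let ?q = "p + monom c j"
  define s' where "s' k = (if k < j then s k else if k = j then
    (if 0 \<le> (-1) ^ s k * coeff ?q k then s k else s k + 1) else s k + 2)" for k
  show ?thesis
  proof (rule sign_var_leI)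
    show "mono s'"
      unfolding mono_iff_le_Suc s'_def using s(1)[unfolded mono_iff_le_Suc]
      by (auto intro: le_SucI)
    show "m \<le> s' k \<and> s' k \<le> m + (n + 2)" for k
      using s(2,3)[of k] by (auto simp: s'_def)
    show "0 \<le> (-1) ^ s' k * coeff ?q k" for k
      using s(4)[of k] by (auto simp: s'_def)
  qed
qed

text \<open>Above \<open>j\<close> all coefficients vanish, so no old sign has to be resumed after
  the new block and one extra block is enough.\<close>

lemma sign_var_le_add_monom_high:
  assumes "sign_var_le n p" and deg: "\<And>k. j < k \<Longrightarrow> coeff p k = 0"
  shows "sign_var_le (n + 1) (p + monom c j)"
proof -
  obtain s m where s: "mono s" "\<And>k. m \<le> s k" "\<And>k. s k \<le> m + n"
    "\<And>k. 0 \<le> (-1) ^ s k * coeff p k"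
    using assms(1) by (rule sign_var_leE) blast
  let ?q = "p + monom c j"
  define s' where "s' k = (if k < j then s k else if k = j then
    (if 0 \<le> (-1) ^ s k * coeff ?q k then s k else s k + 1) else m + n + 1)" for k
  show ?thesis
  proof (rule sign_var_leI)
    show "mono s'"
      unfolding mono_iff_le_Suc s'_def using s(1)[unfolded mono_iff_le_Suc] s(3)
      by (auto intro: le_SucI)
    show "m \<le> s' k \<and> s' k \<le> m + (n + 1)" for k
      using s(2,3)[of k] by (auto simp: s'_def)
    show "0 \<le> (-1) ^ s' k * coeff ?q k" for k
      using s(4)[of k] deg[of k] by (auto simp: s'_def)
  qed
qed

text \<open>The vanishing coefficients below \<open>j\<close> impose no sign, so the block numbers
  can start at \<open>m + 1\<close>; this saves one of the two blocks that an interior monomial may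
  cost.\<close>

lemma sign_var_le_add_monom_low:
  assumes "sign_var_le n p" and low: "\<And>k. k < j \<Longrightarrow> coeff p k = 0"
  shows "sign_var_le (n + 1) (p + monom c j)"
proof -
  obtain s m where s: "mono s" "\<And>k. m \<le> s k" "\<And>k. s k \<le> m + n"
    "\<And>k. 0 \<le> (-1) ^ s k * coeff p k"
    using assms(1) by (rule sign_var_leE) blast
  let ?q = "p + monom c j"
  define s' where "s' k = (if k < j then m + 1 else if k = j then
    (if 0 \<le> (-1) ^ s k * coeff ?q k then s k + 2 else s k + 1) else s k + 2)" for k
  show ?thesis
  proof (rule sign_var_leI)
    show "mono s'"
      unfolding mono_iff_le_Suc s'_def using s(1)[unfolded mono_iff_le_Suc] s(2)
      by (auto intro: le_SucI)
    show "m + 1 \<le> s' k \<and> s' k \<le> m + 1 + (n + 1)" for k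
      using s(2,3)[of k] by (auto simp: s'_def)
    show "0 \<le> (-1) ^ s' k * coeff ?q k" for k
      using s(4)[of k] low[of k] by (auto simp: s'_def)
  qed
qed

section \<open>Positive roots are bounded by sign variations\<close>

lemma poly_pos_of_coeff_nonneg:
  fixes p :: "real poly"
  assumes "p \<noteq> 0" "\<And>k. 0 \<le> coeff p k" "0 < x"
  shows "0 < poly p x"
proof -
  have lead: "0 < coeff p (degree p)"
    using assms(1) assms(2)[of "degree p"] leading_coeff_neq_0[OF assms(1)] by linarith
  have "0 < (\<Sum>i\<le>degree p. coeff p i * x ^ i)"
  proof (rule sum_pos2)
    show "degree p \<in> {..degree p}" by simp
    show "0 < coeff p (degree p) * x ^ degree p" using lead \<open>0 < x\<close> by (rule mult_pos_pos[OF _ zero_less_power])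
    show "0 \<le> coeff p i * x ^ i" if "i \<in> {..degree p}" for i
      using assms(2) \<open>0 < x\<close> by (intro mult_nonneg_nonneg) simp_all
  qed simp
  then show ?thesis by (simp add: poly_altdef)
qed

text \<open>The operator x d/dx - j is diagonal on monomials: it kills x^j and reverses signs
  exactly below it.\<close>

lemma coeff_monom_shift_deriv:
  "coeff (pCons 0 (pderiv p) - smult (of_nat j) p) k = (of_nat k - of_nat j) * coeff (p :: real poly) k"
  by (cases k) (simp_all add: coeff_pderiv left_diff_distrib)

text \<open>Induction on \<open>n\<close>: one differentiation, after division by a suitable power
  of x, removes one sign variation and by Rolle's theorem loses at most one positive root.\<close>

lemma card_pos_roots_le_sign_var:
  assumes "sign_var_le n p" "p \<noteq> 0"
  shows "card {x. 0 < x \<and> poly p x = 0} \<le> n"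
  using assms
proof (induction n arbitrary: p)
  case 0
  obtain s m where s: "mono s" "\<And>k. m \<le> s k" "\<And>k. s k \<le> m + 0"
    "\<And>k. 0 \<le> (-1) ^ s k * coeff p k"
    using 0(1) by (rule sign_var_leE) blast
  have "s k = m" for k using s(2,3)[of k] by simp
  then have "0 < poly (smult ((-1) ^ m) p) x" if "0 < x" for x
    using that s(4) 0 by (intro poly_pos_of_coeff_nonneg) auto
  then have "{x. 0 < x \<and> poly p x = 0} = {}" by fastforce
  then show ?case by (simp only: card.empty)
next
  case (Suc n)
  obtain s m where s: "mono s" "\<And>k. m \<le> s k" "\<And>k. s k \<le> m + Suc n"
    "\<And>k. 0 \<le> (-1) ^ s k * coeff p k"
    using Suc(2) by (rule sign_var_leE) blast
  show ?case
  proof (cases "\<forall>k. s k = m")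
    case True
    \<comment> \<open>Without a second block there is nothing to merge, and the induction hypothesis
      applies to \<open>p\<close> itself.\<close>
    then have "sign_var_le n p" using s by (intro sign_var_leI[of s m]) auto
    then show ?thesis using Suc by (meson le_SucI)
  next
    case False
    define j where "j = (LEAST k. s k \<noteq> m)"
    have j: "s j \<noteq> m" using False unfolding j_def by (metis (mono_tags, lifting) LeastI)
    have below: "s k = m" if "k < j" for k using not_less_Least that unfolding j_def by blast
    have above: "m + 1 \<le> s k" if "j \<le> k" for k
      using j s(2)[of j] monoD[OF s(1) that] by linarith
    \<comment> \<open>\<open>x\<^sup>j\<^sup>+\<^sup>1\<close> times the derivative of \<open>x\<^sup>-\<^sup>j p\<close>: the sign of the first block is flipped,
      so the first two blocks merge.\<close>
    define q where "q = pCons 0 (pderiv p) - smult (of_nat j) p"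
    have coq: "coeff q k = (of_nat k - of_nat j) * coeff p k" for k
      unfolding q_def by (rule coeff_monom_shift_deriv)
    have q: "sign_var_le n q"
    proof (rule sign_var_leI)
      show "mono (\<lambda>k. if k < j then m + 1 else s k)"
        using above monoD[OF s(1)] by (auto simp: mono_def)
      show "m + 1 \<le> (if k < j then m + 1 else s k) \<and> (if k < j then m + 1 else s k) \<le> m + 1 + n" for k
        using above[of k] s(3)[of k] by auto
      show "0 \<le> (-1) ^ (if k < j then m + 1 else s k) * coeff q k" for k
      proof (cases "k < j")
        case True
        have "(-1) ^ (m + 1) * coeff q k = (of_nat j - of_nat k) * ((-1) ^ s k * coeff p k)"
          using below[OF True] by (simp add: coq algebra_simps)
        also have "\<dots> \<ge> 0" using s(4)[of k] True by (intro mult_nonneg_nonneg[OF _ s(4)]) auto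
        finally show ?thesis using True by simp
      next
        case False
        have "(-1) ^ s k * coeff q k = (of_nat k - of_nat j) * ((-1) ^ s k * coeff p k)"
          by (simp add: coq algebra_simps)
        also have "\<dots> \<ge> 0" using s(4)[of k] False by (intro mult_nonneg_nonneg[OF _ s(4)]) auto
        finally show ?thesis using False by simp
      qed
    qed
    show ?thesis
    proof (cases "q = 0")
      case True
      \<comment> \<open>Since only the exponent \<open>j\<close> is killed by the operator,
        \<open>p\<close> is a nonzero multiple of x^j and has no positive root.\<close>
      then have "coeff p k = 0" if "k \<noteq> j" for k using coq[of k] that by simp
      then have "p = monom (coeff p j) j" by (intro poly_eqI) simp
      then have "poly p x = coeff p j * x ^ j" for x by (metis poly_monom)
      moreover have "coeff p j \<noteq> 0" using Suc(3) \<open>p = monom _ _\<close> by (metis monom_eq_0)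
      ultimately have "{x. 0 < x \<and> poly p x = 0} = {}" by auto
      then show ?thesis by (simp only: card.empty)
    next
      case q0: False
      \<comment> \<open>Dividing by powers of x changes no positive root, and the second quotient is
        the derivative of the first.\<close>
      let ?f = "\<lambda>x. poly p x / x ^ j" and ?f' = "\<lambda>x. poly q x / x ^ (j + 1)"
      have roots: "{x. 0 < x \<and> ?f x = 0} = {x. 0 < x \<and> poly p x = 0}"
        "{x. 0 < x \<and> ?f' x = 0} = {x. 0 < x \<and> poly q x = 0}" by auto
      have "(?f has_real_derivative ?f' x) (at x)" if "0 < x" for x
      proof -
        have "((\<lambda>x. x ^ j) has_real_derivative of_nat j * x ^ j / x) (at x)"
          using that DERIV_pow[of j x] by (cases j) auto
        from DERIV_divide[OF poly_DERIV[of p] this]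
        have "(?f has_real_derivative
            (poly (pderiv p) x * x ^ j - poly p x * (of_nat j * x ^ j / x)) / (x ^ j * x ^ j)) (at x)"
          using that by simp
        also have "(poly (pderiv p) x * x ^ j - poly p x * (of_nat j * x ^ j / x)) / (x ^ j * x ^ j)
            = ?f' x"
          using that by (simp add: q_def divide_simps) (simp add: algebra_simps)
        finally show ?thesis .
      qed
      moreover have "finite {x. 0 < x \<and> ?f' x = 0}"
        unfolding roots by (rule finite_subset[OF _ poly_roots_finite[OF q0]]) auto
      ultimately have "card {x. 0 < x \<and> poly p x = 0} \<le> Suc (card {x. 0 < x \<and> poly q x = 0})"
        using card_roots_le_Suc_card_roots_deriv[of ?f ?f'] unfolding roots by blast
      also have "\<dots> \<le> Suc n" using Suc.IH[OF q q0] by simp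
      finally show ?thesis .
    qed
  qed
qed

section \<open>Trinomials in \<open>t\<close> and \<open>1 + t\<close>\<close>

text \<open>This and the next lemma track the range of exponents through Horner's scheme: a factor 1
  + x keeps the lower end and raises the upper end by one. The range decides whether a new monomial
  is extreme.\<close>

lemma coeff_linear_power_mult_eq_0_below:
  fixes p :: "'a::comm_semiring_1 poly"
  assumes "\<And>k. k < m \<Longrightarrow> coeff p k = 0" "k < m"
  shows "coeff ([:1, 1:] ^ r * p) k = 0"
  using assms(2)
proof (induction r arbitrary: k)
  case 0 then show ?case using assms(1) by simp
next
  case (Suc r)
  have "[:1, 1:] ^ Suc r * p = [:1, 1:] ^ r * p + pCons 0 ([:1, 1:] ^ r * p)"
    by (simp add: distrib_right)
  then show ?case using Suc.IH[of k] Suc.IH[of "k - 1"] Suc.prems by (cases k) simp_all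
qed

lemma coeff_linear_power_mult_eq_0_above:
  fixes p :: "'a::comm_semiring_1 poly"
  assumes "\<And>k. m < k \<Longrightarrow> coeff p k = 0" "m + r < k"
  shows "coeff ([:1, 1:] ^ r * p) k = 0"
  using assms(2)
proof (induction r arbitrary: k)
  case 0 then show ?case using assms(1) by simp
next
  case (Suc r)
  have "[:1, 1:] ^ Suc r * p = [:1, 1:] ^ r * p + pCons 0 ([:1, 1:] ^ r * p)"
    by (simp add: distrib_right)
  then show ?case using Suc.IH[of k] Suc.IH[of "k - 1"] Suc.prems by (cases k) simp_all
qed

definition pos_roots :: "'i set \<Rightarrow> ('i \<Rightarrow> real) \<Rightarrow> ('i \<Rightarrow> nat) \<Rightarrow> ('i \<Rightarrow> nat) \<Rightarrow> real set" where
  "pos_roots I c a b = {t. 0 < t \<and> (\<Sum>i\<in>I. c i * t ^ a i * (1 + t) ^ b i) = 0}"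

text \<open>
  Horner's scheme in \<open>1 + t\<close>: only the two additions of a monomial create sign variations,
  at most two each, and at most one if the new monomial has extreme degree.
\<close>

lemma card_pos_roots_trinomial:
  fixes c :: "'i \<Rightarrow> real"
  assumes I: "I = {i, j, k}" and dist: "i \<noteq> j" "i \<noteq> k" "j \<noteq> k"
    and ord: "b j \<le> b i" "b k \<le> b j"
    and hom: "\<And>l. l \<in> I \<Longrightarrow> a l + b l + g l = d"
    and fin: "finite (pos_roots I c a b)"
  shows "card (pos_roots I c a b) \<le> 2 + of_bool (a i < a j \<and> g i < g j)
    + of_bool ((a i < a k \<or> a j < a k) \<and> (g i < g k \<or> g j < g k))"
proof -
  have d: "a i + b i + g i = d" "a j + b j + g j = d" "a k + b k + g k = d"
    using hom I by auto
  define L :: "real poly" where "L = [:1, 1:]"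
  define p1 where "p1 = L ^ (b i - b j) * monom (c i) (a i)"
  define p2 where "p2 = p1 + monom (c j) (a j)"
  define p3 where "p3 = L ^ (b j - b k) * p2"
  define p4 where "p4 = p3 + monom (c k) (a k)"
  define p5 where "p5 = L ^ b k * p4"
  define n :: nat where "n = 1 + of_bool (a i < a j \<and> g i < g j)"
  define m :: nat where "m = 1 + of_bool ((a i < a k \<or> a j < a k) \<and> (g i < g k \<or> g j < g k))"
  have low1: "coeff p1 r = 0" if "r < a i" for r
    unfolding p1_def L_def using that by (intro coeff_linear_power_mult_eq_0_below[of "a i"]) simp_all
  have high1: "coeff p1 r = 0" if "a i + (b i - b j) < r" for r
    unfolding p1_def L_def using that by (intro coeff_linear_power_mult_eq_0_above[of "a i"]) simp_all
  have sv1: "sign_var_le 0 p1"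
    unfolding p1_def L_def by (intro sign_var_le_linear_power_mult sign_var_le_monom)
  have sv2: "sign_var_le n p2"
  \<comment> \<open>By \<open>hom\<close>, \<open>g i < g j\<close> means
    \<open>a j < a i + (b i - b j)\<close>. So the condition says that the new exponent lies
    strictly inside the exponent range of \<open>p1\<close>.\<close>
  proof (cases "a i < a j \<and> g i < g j")
    case True
    then show ?thesis using sign_var_le_add_monom[OF sv1, of "c j" "a j"] by (simp add: n_def p2_def)
  next
    case False
    have "sign_var_le (0 + 1) (p1 + monom (c j) (a j))"
    proof (cases "a j \<le> a i")
      case True then show ?thesis by (intro sign_var_le_add_monom_low[OF sv1] low1) simp
    next
      case False': False
      then have "a i + (b i - b j) \<le> a j" using False d ord by linarith
      then show ?thesis by (intro sign_var_le_add_monom_high[OF sv1] high1) simp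
    qed
    then show ?thesis using False by (auto simp: n_def p2_def)
  qed
  have low2: "coeff p2 r = 0" if "r < min (a i) (a j)" for r
    unfolding p2_def using that low1 by simp
  have high2: "coeff p2 r = 0" if "max (a i + (b i - b j)) (a j) < r" for r
    unfolding p2_def using that high1 by simp
  have low3: "coeff p3 r = 0" if "r < min (a i) (a j)" for r
    unfolding p3_def L_def using that low2
    by (intro coeff_linear_power_mult_eq_0_below[of "min (a i) (a j)"])
  have high3: "coeff p3 r = 0" if "max (a i + (b i - b j)) (a j) + (b j - b k) < r" for r
    unfolding p3_def L_def using that high2
    by (intro coeff_linear_power_mult_eq_0_above[of "max (a i + (b i - b j)) (a j)"])
  have sv3: "sign_var_le n p3"
    unfolding p3_def L_def by (intro sign_var_le_linear_power_mult sv2)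
  have sv4: "sign_var_le (n + m) p4"
  \<comment> \<open>The same test against the range of \<open>p3\<close>, whose lower end is a
    minimum and whose upper end is a maximum over the first two terms; hence the
    disjunctions.\<close>
  proof (cases "(a i < a k \<or> a j < a k) \<and> (g i < g k \<or> g j < g k)")
    case True
    then show ?thesis using sign_var_le_add_monom[OF sv3, of "c k" "a k"] by (simp add: m_def p4_def)
  next
    case False
    have "sign_var_le (n + 1) (p3 + monom (c k) (a k))"
    proof (cases "a i < a k \<or> a j < a k")
      case True
      then have "max (a i + (b i - b j)) (a j) + (b j - b k) \<le> a k" using False d ord by linarith
      then show ?thesis by (intro sign_var_le_add_monom_high[OF sv3] high3) simp
    next
      case False
      then show ?thesis by (intro sign_var_le_add_monom_low[OF sv3] low3) simp
    qed
    then show ?thesis using False by (auto simp: m_def p4_def)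
  qed
  have sv5: "sign_var_le (n + m) p5"
    unfolding p5_def L_def by (intro sign_var_le_linear_power_mult sv4)
  have pw: "(1 + t) ^ b i = (1 + t) ^ (b i - b j) * (1 + t) ^ (b j - b k) * (1 + t) ^ b k"
    "(1 + t) ^ b j = (1 + t) ^ (b j - b k) * (1 + t) ^ b k" for t :: real
    using ord by (simp_all flip: power_add)
  have eval: "poly p5 t = (\<Sum>i\<in>I. c i * t ^ a i * (1 + t) ^ b i)" for t
    unfolding p5_def p4_def p3_def p2_def p1_def L_def I using dist
    by (simp add: poly_monom pw algebra_simps)
  have roots: "pos_roots I c a b = {t. 0 < t \<and> poly p5 t = 0}"
    by (simp add: pos_roots_def eval)
  have "p5 \<noteq> 0"
  proof
    assume "p5 = 0"
    then have "pos_roots I c a b = {0<..}" unfolding roots by auto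
    then show False using fin infinite_Ioi by metis
  qed
  then have "card (pos_roots I c a b) \<le> n + m"
    unfolding roots by (rule card_pos_roots_le_sign_var[OF sv5])
  then show ?thesis by (simp add: n_def m_def)
qed

section \<open>Root bounds on one interval and on two intervals together\<close>

lemma card_3_sorted:
  fixes b :: "'i \<Rightarrow> nat"
  assumes "card I = 3"
  obtains i j k where "I = {i, j, k}" "i \<noteq> j" "i \<noteq> k" "j \<noteq> k" "b j \<le> b i" "b k \<le> b j"
proof -
  obtain x y z where xyz: "I = {x, y, z}" "x \<noteq> y" "x \<noteq> z" "y \<noteq> z"
    using assms by (auto simp: card_3_iff)
  have perm: "{x, y, z} = {x, z, y}" "{x, y, z} = {y, x, z}" "{x, y, z} = {y, z, x}"
    "{x, y, z} = {z, x, y}" "{x, y, z} = {z, y, x}" by auto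
  show thesis
    using that[of x y z] that[of x z y] that[of y x z] that[of y z x] that[of z x y] that[of z y x]
      xyz perm by (metis nat_le_linear)
qed

text \<open>Four roots require both additions in Horner's scheme to cost two variations. Then the
  term with the largest \<open>b\<close>, from which the scheme starts, is strictly smallest in both
  \<open>a\<close> and \<open>g\<close>.\<close>

lemma card_pos_roots_trinomial_cases:
  fixes c :: "'i \<Rightarrow> real"
  assumes card: "card I = 3" and hom: "\<And>l. l \<in> I \<Longrightarrow> a l + b l + g l = d"
    and fin: "finite (pos_roots I c a b)"
  shows "card (pos_roots I c a b) \<le> 3 \<or> card (pos_roots I c a b) = 4 \<and>
    (\<exists>i\<in>I. \<forall>j\<in>I - {i}. a i < a j \<and> g i < g j)"
proof -
  obtain i j k where I: "I = {i, j, k}" "i \<noteq> j" "i \<noteq> k" "j \<noteq> k" "b j \<le> b i" "b k \<le> b j"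
    using card by (rule card_3_sorted)
  note bound = card_pos_roots_trinomial[OF I hom fin]
  show ?thesis
  proof (cases "a i < a j \<and> g i < g j \<and> (a i < a k \<or> a j < a k) \<and> (g i < g k \<or> g j < g k)")
    case True
    then have "card (pos_roots I c a b) \<le> 4" using bound by simp
    moreover have "\<forall>l\<in>I - {i}. a i < a l \<and> g i < g l" using True I by auto
    ultimately show ?thesis using I(1) by force
  next
    case False
    then have "card (pos_roots I c a b) \<le> 3" using bound by (auto simp: of_bool_def split: if_splits)
    then show ?thesis ..
  qed
qed

text \<open>The term \<open>i\<close> has the smallest \<open>b\<close>, so it is added last; being
  smallest in \<open>a\<close> or in \<open>g\<close> as well, it is extreme and costs one
  variation. Only the addition joining the other two terms can cost two. The bound is symmetric in
  \<open>j\<close> and \<open>k\<close>, whichever of them comes first.\<close>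

lemma card_pos_roots_trinomial_min:
  fixes c :: "'i \<Rightarrow> real"
  assumes I: "I = {i, j, k}" and dist: "i \<noteq> j" "i \<noteq> k" "j \<noteq> k"
    and min: "b i < b j" "b i < b k" "a i < a j \<and> a i < a k \<or> g i < g j \<and> g i < g k"
    and hom: "\<And>l. l \<in> I \<Longrightarrow> a l + b l + g l = d"
    and fin: "finite (pos_roots I c a b)"
  shows "card (pos_roots I c a b)
    \<le> 2 + of_bool (a j < a k \<and> g j < g k \<or> a k < a j \<and> g k < g j)"
proof (cases "b k \<le> b j")
  case True
  have "I = {j, k, i}" using I by auto
  from card_pos_roots_trinomial[OF this _ _ _ True _ hom fin] dist min
  show ?thesis by (auto simp: of_bool_def split: if_splits)
next
  case False
  have "I = {k, j, i}" using I by auto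
  from card_pos_roots_trinomial[OF this _ _ _ _ _ hom fin] dist min False
  show ?thesis by (auto simp: of_bool_def split: if_splits)
qed

text \<open>
  The two intervals cannot both reach three roots, as \<open>b\<close> would have to order the other two terms
  like \<open>g\<close> for the first, like \<open>a\<close> for the second, and \<open>a + b + g\<close> is constant.
\<close>

lemma card_pos_roots_pair:
  fixes c1 c2 :: "'i \<Rightarrow> real"
  assumes card: "card I = 3" and i: "i \<in> I" "\<And>j. j \<in> I - {i} \<Longrightarrow> a i < a j \<and> g i < g j"
    and hom: "\<And>l. l \<in> I \<Longrightarrow> a l + b l + g l = d"
    and p: "p = b \<or> p = g" and q: "q = a \<or> q = b"
    and fin: "finite (pos_roots I c1 p a)" "finite (pos_roots I c2 q g)"
  shows "card (pos_roots I c1 p a) + card (pos_roots I c2 q g) \<le> 5"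
proof -
  have "card (I - {i}) = 2" using card i(1) by simp
  then obtain j k where jk: "I - {i} = {j, k}" "j \<noteq> k" by (auto simp: card_2_iff)
  then have I: "I = {i, j, k}" "i \<noteq> j" "i \<noteq> k" using i(1) by auto
  have lt: "a i < a j" "a i < a k" "g i < g j" "g i < g k" using i(2) jk by auto
  note min = card_pos_roots_trinomial_min[where d = d, OF I jk(2)]
  \<comment> \<open>For either choice of \<open>p\<close>, the exponents other than \<open>a\<close>
    are \<open>b\<close> and \<open>g\<close>, and the bound is symmetric in them.\<close>
  have "card (pos_roots I c1 p a) \<le> 2 + of_bool (b j < b k \<and> g j < g k \<or> b k < b j \<and> g k < g j)"
    using p
  proof
    assume "p = b"
    then show ?thesis using min[of a b g c1] lt hom fin(1) by (simp add: add_ac)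
  next
    assume "p = g"
    then show ?thesis using min[of a g b c1] lt hom fin(1) by (simp add: add_ac conj_commute)
  qed
  moreover have "card (pos_roots I c2 q g) \<le> 2 + of_bool (a j < a k \<and> b j < b k \<or> a k < a j \<and> b k < b j)"
    using q
  proof
    assume "q = a"
    then show ?thesis using min[of g a b c2] lt hom fin(2) by (simp add: add_ac)
  next
    assume "q = b"
    then show ?thesis using min[of g b a c2] lt hom fin(2) by (simp add: add_ac conj_commute)
  qed
  moreover have "a j + b j + g j = a k + b k + g k" using hom I(1) by auto
  ultimately show ?thesis by (auto simp: of_bool_def split: if_splits)
qed

section \<open>Trinomials on a line\<close>

lemma finite_card_of_image_subset:
  assumes "inj_on f A" "f ` A \<subseteq> Z" "finite Z"
  shows "finite A" "card (f ` A) = card A"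
  using finite_imageD[OF finite_subset[OF assms(2,3)] assms(1)] card_image[OF assms(1)] .

lemma card_zeros_trinomial_x_Suc_x:
  fixes c :: "'i \<Rightarrow> real" and \<alpha> \<beta> :: "'i \<Rightarrow> nat"
  assumes card: "card I = 3"
    and fin: "finite {x. (\<Sum>i\<in>I. c i * x ^ \<alpha> i * (1 + x) ^ \<beta> i) = 0}"
  shows "card {x. (\<Sum>i\<in>I. c i * x ^ \<alpha> i * (1 + x) ^ \<beta> i) = 0} \<le> 11"
proof -
  define G where "G x = (\<Sum>i\<in>I. c i * x ^ \<alpha> i * (1 + x) ^ \<beta> i)" for x
  define Z where "Z = {x. G x = 0}"
  have finZ: "finite Z" using fin by (simp add: Z_def G_def)
  have finI: "finite I" using card by (metis card.infinite zero_neq_numeral)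
  \<comment> \<open>Any common upper bound of the total degrees would serve as \<open>d\<close>; it
    makes the subtraction in \<open>\<gamma>\<close> exact.\<close>
  define d where "d = (\<Sum>i\<in>I. \<alpha> i + \<beta> i)"
  define \<gamma> where "\<gamma> i = d - \<alpha> i - \<beta> i" for i
  have hom: "\<alpha> i + \<beta> i + \<gamma> i = d" if "i \<in> I" for i
    using member_le_sum[OF that, of "\<lambda>i. \<alpha> i + \<beta> i"] finI by (simp add: d_def \<gamma>_def)
  define P where "P = pos_roots I c \<alpha> \<beta>"
  define Q where "Q = pos_roots I (\<lambda>i. c i * (-1) ^ \<alpha> i) \<alpha> \<gamma>"
  define R where "R = pos_roots I (\<lambda>i. c i * (-1) ^ (\<alpha> i + \<beta> i)) \<beta> \<alpha>"
  \<comment> \<open>\<open>f\<close> maps the positive half-line onto the interval from -1 to 0, and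
    \<open>h\<close> maps it onto the numbers below -1. Clearing the denominators of
    \<open>f\<close> leaves 1 + t with the third exponent \<open>\<gamma>\<close>.\<close>
  define f :: "real \<Rightarrow> real" where "f t = - t / (1 + t)" for t
  define h :: "real \<Rightarrow> real" where "h t = - 1 - t" for t
  have Q_iff: "(\<Sum>i\<in>I. c i * (-1) ^ \<alpha> i * t ^ \<alpha> i * (1 + t) ^ \<gamma> i) = 0 \<longleftrightarrow> G (f t) = 0"
    if "0 < t" for t
  proof -
    have "c i * (-1) ^ \<alpha> i * t ^ \<alpha> i * (1 + t) ^ \<gamma> i
        = (1 + t) ^ d * (c i * f t ^ \<alpha> i * (1 + f t) ^ \<beta> i)" if "i \<in> I" for i
    proof -
      have "1 + f t = 1 / (1 + t)" "f t = (-1) * t / (1 + t)"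
        using \<open>0 < t\<close> by (simp_all add: f_def field_simps)
      then have "f t ^ \<alpha> i = (-1) ^ \<alpha> i * t ^ \<alpha> i / (1 + t) ^ \<alpha> i" "(1 + f t) ^ \<beta> i = 1 / (1 + t) ^ \<beta> i"
        by (simp_all only: power_divide power_mult_distrib power_one)
      moreover have "(1 + t) ^ d = (1 + t) ^ \<alpha> i * (1 + t) ^ \<beta> i * (1 + t) ^ \<gamma> i"
        using hom[OF that] by (metis power_add)
      ultimately show ?thesis
        using \<open>0 < t\<close> by simp
    qed
    then have "(\<Sum>i\<in>I. c i * (-1) ^ \<alpha> i * t ^ \<alpha> i * (1 + t) ^ \<gamma> i) = (1 + t) ^ d * G (f t)"
      unfolding G_def sum_distrib_left by (rule sum.cong[OF refl])
    then show ?thesis using that by simp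
  qed
  have R_eq: "(\<Sum>i\<in>I. c i * (-1) ^ (\<alpha> i + \<beta> i) * t ^ \<beta> i * (1 + t) ^ \<alpha> i) = G (h t)" for t
    unfolding G_def
  proof (rule sum.cong[OF refl])
    fix i
    have "h t = (-1) * (1 + t)" "1 + h t = (-1) * t" by (simp_all add: h_def)
    then have "h t ^ \<alpha> i = (-1) ^ \<alpha> i * (1 + t) ^ \<alpha> i" "(1 + h t) ^ \<beta> i = (-1) ^ \<beta> i * t ^ \<beta> i"
      by (simp_all only: power_mult_distrib)
    then show "c i * (-1) ^ (\<alpha> i + \<beta> i) * t ^ \<beta> i * (1 + t) ^ \<alpha> i = c i * h t ^ \<alpha> i * (1 + h t) ^ \<beta> i"
      by (simp add: power_add)
  qed
  have "P \<subseteq> Z" "f ` Q \<subseteq> Z" "h ` R \<subseteq> Z"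
    using Q_iff by (auto simp: P_def Q_def R_def Z_def pos_roots_def R_eq simp flip: G_def)
  moreover have "inj_on f Q" "inj_on h R"
    by (auto simp: inj_on_def f_def h_def Q_def pos_roots_def frac_eq_eq algebra_simps)
  ultimately have finP: "finite P" and Q: "finite Q" "card (f ` Q) = card Q"
    and R: "finite R" "card (h ` R) = card R"
    using finite_subset[of P Z] finite_card_of_image_subset[of f Q Z]
      finite_card_of_image_subset[of h R Z] finZ by simp_all
  have "Z \<subseteq> {0, -1} \<union> (P \<union> (f ` Q \<union> h ` R))"
  proof
    fix x assume x: "x \<in> Z"
    consider "x = 0" | "x = -1" | "0 < x" | "-1 < x" "x < 0" | "x < -1" by linarith
    then show "x \<in> {0, -1} \<union> (P \<union> (f ` Q \<union> h ` R))"
    proof cases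
      case 3
      then show ?thesis using x by (auto simp: P_def Z_def pos_roots_def G_def)
    next
      case 4
      define t where "t = - x / (1 + x)"
      have "0 < t" "x = f t" using 4 by (simp_all add: t_def f_def field_simps)
      then show ?thesis using x Q_iff[of t] by (auto simp: Q_def Z_def pos_roots_def)
    next
      case 5
      define t where "t = - 1 - x"
      have "0 < t" "x = h t" using 5 by (simp_all add: t_def h_def)
      then show ?thesis using x R_eq[of t] by (auto simp: R_def Z_def pos_roots_def)
    qed auto
  qed
  then have "card Z \<le> card ({0, -1} \<union> (P \<union> (f ` Q \<union> h ` R)))"
    using finP Q(1) R(1) by (intro card_mono) auto
  also have "\<dots> \<le> card {0, -1 :: real} + (card P + (card (f ` Q) + card (h ` R)))"
    by (meson add_left_mono card_Un_le le_trans)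
  finally have Z: "card Z \<le> 2 + card P + card Q + card R" by (simp add: Q(2) R(2))
  have casesP: "card P \<le> 3 \<or> card P = 4 \<and> (\<exists>i\<in>I. \<forall>j\<in>I - {i}. \<alpha> i < \<alpha> j \<and> \<gamma> i < \<gamma> j)"
    unfolding P_def by (rule card_pos_roots_trinomial_cases[OF card hom finP[unfolded P_def]])
  have casesQ: "card Q \<le> 3 \<or> card Q = 4 \<and> (\<exists>i\<in>I. \<forall>j\<in>I - {i}. \<alpha> i < \<alpha> j \<and> \<beta> i < \<beta> j)"
    unfolding Q_def using hom
    by (intro card_pos_roots_trinomial_cases[where d = d, OF card _ Q(1)[unfolded Q_def]]) (simp add: add_ac)
  have casesR: "card R \<le> 3 \<or> card R = 4 \<and> (\<exists>i\<in>I. \<forall>j\<in>I - {i}. \<beta> i < \<beta> j \<and> \<gamma> i < \<gamma> j)"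
    unfolding R_def using hom
    by (intro card_pos_roots_trinomial_cases[where d = d, OF card _ R(1)[unfolded R_def]]) (simp add: add_ac)
  \<comment> \<open>Here and in the next two steps, \<open>b\<close> in the pair lemma is the
    exponent in which the distinguished term is not claimed to be smallest.\<close>
  have "card R + card Q \<le> 5" if four: "card P = 4"
  proof -
    obtain i where "i \<in> I" "\<And>j. j \<in> I - {i} \<Longrightarrow> \<alpha> i < \<alpha> j \<and> \<gamma> i < \<gamma> j"
      using casesP four by auto
    then show ?thesis using hom finP Q(1) R(1) unfolding Q_def R_def
      by (intro card_pos_roots_pair[where b = \<beta> and d = d, OF card]) auto
  qed
  moreover have "card R + card P \<le> 5" if four: "card Q = 4"
  proof -
    obtain i where "i \<in> I" "\<And>j. j \<in> I - {i} \<Longrightarrow> \<alpha> i < \<alpha> j \<and> \<beta> i < \<beta> j"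
      using casesQ four by auto
    then show ?thesis using hom finP Q(1) R(1) unfolding P_def R_def
      by (intro card_pos_roots_pair[where b = \<gamma> and d = d, OF card]) (auto simp: add_ac)
  qed
  moreover have "card P + card Q \<le> 5" if four: "card R = 4"
  proof -
    obtain i where "i \<in> I" "\<And>j. j \<in> I - {i} \<Longrightarrow> \<beta> i < \<beta> j \<and> \<gamma> i < \<gamma> j"
      using casesR four by auto
    then show ?thesis using hom finP Q(1) R(1) unfolding P_def Q_def
      by (intro card_pos_roots_pair[where b = \<alpha> and d = d, OF card]) (auto simp: add_ac)
  qed
  \<comment> \<open>Either no count exceeds three, or one equals four and the other two add up to at
    most five.\<close>
  ultimately have "card P + card Q + card R \<le> 9"
    using casesP casesQ casesR by linarith
  then show ?thesis using Z unfolding Z_def G_def by linarith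
qed

text \<open>Serves the degenerate lines, where the restriction is a trinomial in one variable. The
  crude bound of four roots on each half-line, together with 0, is already below eleven.\<close>

lemma card_zeros_trinomial:
  fixes c :: "'i \<Rightarrow> real" and n :: "'i \<Rightarrow> nat"
  assumes card: "card I = 3" and fin: "finite {x. (\<Sum>i\<in>I. c i * x ^ n i) = 0}"
  shows "card {x. (\<Sum>i\<in>I. c i * x ^ n i) = 0} \<le> 11"
proof -
  define Z where "Z = {x. (\<Sum>i\<in>I. c i * x ^ n i) = 0}"
  define c' where "c' i = c i * (-1) ^ n i" for i
  have finI: "finite I" using card by (metis card.infinite zero_neq_numeral)
  have hom: "n i + 0 + (sum n I - n i) = sum n I" if "i \<in> I" for i
    using member_le_sum[OF that, of n] finI by simp
  have bound: "card (pos_roots I e n (\<lambda>_. 0)) \<le> 4" if "finite (pos_roots I e n (\<lambda>_. 0))" for e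
    using card_pos_roots_trinomial_cases[OF card hom that] by auto
  have neg: "c' i * t ^ n i = c i * (- t) ^ n i" for i t
    by (simp add: c'_def mult.assoc flip: power_mult_distrib)
  have sub: "pos_roots I c n (\<lambda>_. 0) \<subseteq> Z" "uminus ` pos_roots I c' n (\<lambda>_. 0) \<subseteq> Z"
    by (auto simp: Z_def pos_roots_def neg)
  have fin1: "finite (pos_roots I c n (\<lambda>_. 0))"
    using sub(1) fin finite_subset unfolding Z_def by blast
  have fin2: "finite (pos_roots I c' n (\<lambda>_. 0))"
    using finite_card_of_image_subset(1)[OF _ sub(2)] fin by (simp add: Z_def)
  have "Z \<subseteq> {0} \<union> (pos_roots I c n (\<lambda>_. 0) \<union> uminus ` pos_roots I c' n (\<lambda>_. 0))"
  proof
    fix x assume x: "x \<in> Z"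
    have "x = - (- x)" by simp
    then show "x \<in> {0} \<union> (pos_roots I c n (\<lambda>_. 0) \<union> uminus ` pos_roots I c' n (\<lambda>_. 0))"
      using x by (cases x "0 :: real" rule: linorder_cases)
        (auto simp: Z_def pos_roots_def neg intro!: image_eqI[of x uminus "- x"])
  qed
  then have "card Z \<le> card ({0} \<union> (pos_roots I c n (\<lambda>_. 0) \<union> uminus ` pos_roots I c' n (\<lambda>_. 0)))"
    using fin1 fin2 by (intro card_mono) auto
  also have "\<dots> \<le> card {0 :: real} + (card (pos_roots I c n (\<lambda>_. 0)) + card (uminus ` pos_roots I c' n (\<lambda>_. 0)))"
    by (meson add_left_mono card_Un_le le_trans)
  also have "\<dots> \<le> 1 + (4 + 4)"
    using bound[OF fin1] bound[OF fin2] card_image_le[OF fin2, of uminus] by simp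
  finally show ?thesis by (simp add: Z_def)
qed

lemma finite_card_zeros_affine:
  fixes G :: "real \<Rightarrow> real"
  assumes "B \<noteq> 0"
  shows "finite {s. G (A + B * s) = 0} \<longleftrightarrow> finite {t. G t = 0}"
    and "card {s. G (A + B * s) = 0} = card {t. G t = 0}"
proof -
  have "bij_betw (\<lambda>s. A + B * s) {s. G (A + B * s) = 0} {t. G t = 0}"
    using assms by (intro bij_betw_byWitness[where f' = "\<lambda>t. (t - A) / B"]) auto
  then show "finite {s. G (A + B * s) = 0} \<longleftrightarrow> finite {t. G t = 0}"
    and "card {s. G (A + B * s) = 0} = card {t. G t = 0}"
    by (simp_all add: bij_betw_finite bij_betw_same_card)
qed

lemma card_zeros_trinomial_line:
  fixes c :: "'i \<Rightarrow> real" and \<alpha> \<beta> :: "'i \<Rightarrow> nat"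
  assumes card: "card I = 3" and dir: "u \<noteq> 0 \<or> v \<noteq> 0"
    and fin: "finite {t. (\<Sum>i\<in>I. c i * (p + t * u) ^ \<alpha> i * (q + t * v) ^ \<beta> i) = 0}"
  shows "card {t. (\<Sum>i\<in>I. c i * (p + t * u) ^ \<alpha> i * (q + t * v) ^ \<beta> i) = 0} \<le> 11"
proof -
  define G where "G t = (\<Sum>i\<in>I. c i * (p + t * u) ^ \<alpha> i * (q + t * v) ^ \<beta> i)" for t
  have finG: "finite {t. G t = 0}" using fin by (simp add: G_def)
  have univariate: ?thesis
    if "B \<noteq> 0" "\<And>s. G (A + B * s) = (\<Sum>i\<in>I. e i * s ^ n i)" for A B n and e :: "'i \<Rightarrow> real"
    using card_zeros_trinomial[OF card, of e n] finite_card_zeros_affine[OF that(1), of G A] finG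
    by (simp add: that(2) flip: G_def)
  \<comment> \<open>The lines parallel to a coordinate axis, those through the origin, and those in
    general position.\<close>
  consider "u = 0" | "v = 0" | "u \<noteq> 0" "v \<noteq> 0" "p / u = q / v" | "u \<noteq> 0" "v \<noteq> 0" "p / u \<noteq> q / v"
    by blast
  then show ?thesis
  proof cases
    case 1
    then have "v \<noteq> 0" using dir by simp
    then show ?thesis
      using 1 by (intro univariate[of "1 / v" "- q / v" "\<lambda>i. c i * p ^ \<alpha> i" \<beta>])
        (simp_all add: G_def field_simps)
  next
    case 2
    then have "u \<noteq> 0" using dir by simp
    then show ?thesis
      using 2 by (intro univariate[of "1 / u" "- p / u" "\<lambda>i. c i * q ^ \<beta> i" \<alpha>])
        (simp_all add: G_def field_simps)
  next
    case 3
    have "G (- p / u + 1 * s) = (\<Sum>i\<in>I. c i * u ^ \<alpha> i * v ^ \<beta> i * s ^ (\<alpha> i + \<beta> i))" for s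
    proof -
      have "p + (- p / u + 1 * s) * u = u * s" "q + (- p / u + 1 * s) * v = v * s"
        using 3 by (simp_all add: field_simps)
      then show ?thesis by (simp add: G_def power_mult_distrib power_add mult_ac)
    qed
    then show ?thesis by (rule univariate[OF one_neq_zero])
  next
    case 4
    \<comment> \<open>The new parameter \<open>s\<close> is 0 where the line meets x = 0 and -1
      where it meets y = 0. The remaining scale factors are absorbed into the coefficients.\<close>
    define \<delta> where "\<delta> = q / v - p / u"
    have \<delta>: "\<delta> \<noteq> 0" using 4 by (simp add: \<delta>_def)
    have G: "G (- p / u + \<delta> * s) = (\<Sum>i\<in>I. c i * (u * \<delta>) ^ \<alpha> i * (v * \<delta>) ^ \<beta> i * s ^ \<alpha> i * (1 + s) ^ \<beta> i)" for s
    proof -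
      have "p + (- p / u + \<delta> * s) * u = (u * \<delta>) * s" "q + (- p / u + \<delta> * s) * v = (v * \<delta>) * (1 + s)"
        using 4 by (simp_all add: \<delta>_def field_simps)
      then show ?thesis unfolding G_def by (simp only: power_mult_distrib mult_ac)
    qed
    have "card {s. G (- p / u + \<delta> * s) = 0} \<le> 11"
      using finite_card_zeros_affine(1)[OF \<delta>, of G "- p / u"] finG unfolding G
      by (intro card_zeros_trinomial_x_Suc_x[OF card]) blast
    then show ?thesis
      unfolding finite_card_zeros_affine(2)[OF \<delta>] by (simp only: G_def)
  qed
qed

section \<open>Parametrised lines and their intersection with the curve\<close>

lemma affine_hull_pair_eq_range:
  fixes a b :: "real \<times> real"
  shows "affine hull {a, b} = range (\<lambda>t. (fst a + t * (fst b - fst a), snd a + t * (snd b - snd a)))"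
proof -
  have "u + v = 1 \<longleftrightarrow> u = 1 - v" for u v :: real by auto
  then have "affine hull {a, b} = {(1 - t) *\<^sub>R a + t *\<^sub>R b | t. True}"
    by (simp add: affine_hull_2)
  also have "\<dots> = range (\<lambda>t. (fst a + t * (fst b - fst a), snd a + t * (snd b - snd a)))"
    by (auto simp: image_def prod_eq_iff algebra_simps)
  finally show ?thesis .
qed

lemma is_line_iff:
  "is_line L \<longleftrightarrow> (\<exists>p q u v. (u \<noteq> 0 \<or> v \<noteq> 0) \<and> L = range (\<lambda>t. (p + t * u, q + t * v)))"
proof
  assume "is_line L"
  then obtain B where B: "affine hull B = L" "int (card B) = aff_dim L + 1"
    using aff_dim_basis_exists[of L] hull_same[of affine L] by (metis is_line_def)
  then have "card B = 2" using \<open>is_line L\<close> by (simp add: is_line_def)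
  then obtain a b where ab: "B = {a, b}" "a \<noteq> b" by (auto simp: card_2_iff)
  have "fst b - fst a \<noteq> 0 \<or> snd b - snd a \<noteq> 0" using ab(2) by (auto simp: prod_eq_iff)
  then show "\<exists>p q u v. (u \<noteq> 0 \<or> v \<noteq> 0) \<and> L = range (\<lambda>t. (p + t * u, q + t * v))"
    using B(1) unfolding ab(1) affine_hull_pair_eq_range by blast
next
  assume "\<exists>p q u v. (u \<noteq> 0 \<or> v \<noteq> 0) \<and> L = range (\<lambda>t. (p + t * u, q + t * v))"
  then obtain p q u v where dir: "u \<noteq> 0 \<or> v \<noteq> 0" and L: "L = range (\<lambda>t. (p + t * u, q + t * v))"
    by blast
  have "L = affine hull {(p, q), (p + u, q + v)}" by (simp add: L affine_hull_pair_eq_range)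
  moreover have "(p, q) \<noteq> (p + u, q + v)" using dir by auto
  ultimately show "is_line L"
    unfolding is_line_def by (simp add: affine_affine_hull aff_dim_affine_hull aff_dim_2)
qed

lemma card_line_Int_trinomial_curve:
  assumes "num_terms2 f = 3" "is_line L" "finite (L \<inter> real_curve f)"
  shows "card (L \<inter> real_curve f) \<le> 11"
proof -
  obtain p q u v where dir: "u \<noteq> 0 \<or> v \<noteq> 0" and L: "L = range (\<lambda>t. (p + t * u, q + t * v))"
    using assms(2) unfolding is_line_iff by blast
  define M where "M = monomials2 f"
  have card: "card M = 3" using assms(1) by (simp add: M_def num_terms2_def)
  let ?Z = "{t. (\<Sum>m\<in>M. coeff (coeff f (snd m)) (fst m) * (p + t * u) ^ fst m * (q + t * v) ^ snd m) = 0}"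
  have inj: "inj_on (\<lambda>t. (p + t * u, q + t * v)) ?Z" using dir by (auto simp: inj_on_def)
  have eq: "L \<inter> real_curve f = (\<lambda>t. (p + t * u, q + t * v)) ` ?Z"
    by (auto simp: L real_curve_def eval2_eq_sum_monomials2 M_def case_prod_beta)
  have "finite ?Z" using assms(3) inj finite_imageD unfolding eq by blast
  then show ?thesis
    unfolding eq card_image[OF inj] by (rule card_zeros_trinomial_line[OF card dir])
qed

section \<open>A trinomial with eleven roots\<close>

text \<open>
  On the line \<open>y = 1 + x\<close> the common factor \<open>x y\<close> of the three terms contributes the roots \<open>0\<close> and \<open>-1\<close>,
  and the cofactor has two sign changes in \<open>x < -1\<close>, three in \<open>-1 < x < 0\<close> and four in \<open>0 < x\<close>.
\<close>

definition trinomial_witness :: "real poly poly" where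
  "trinomial_witness = monom (monom 1 3) 1 + monom (monom 29 6) 3 + monom (monom (- 601 / 250000) 1) 18"

definition witness_cofactor :: "real \<Rightarrow> real" where
  "witness_cofactor x = x ^ 2 + 29 * x ^ 5 * (1 + x) ^ 2 - 601 / 250000 * (1 + x) ^ 17"

lemma monomials2_trinomial_witness:
  "monomials2 trinomial_witness = {(3, 1), (6, 3), (1, 18)}"
proof -
  have "coeff (coeff trinomial_witness j) i = (if j = 1 \<and> i = 3 then 1 else 0)
      + (if j = 3 \<and> i = 6 then 29 else 0) + (if j = 18 \<and> i = 1 then - 601 / 250000 else 0)" for i j
    by (simp add: trinomial_witness_def)
  then show ?thesis by (auto simp: monomials2_def split: if_splits)
qed

lemma eval2_trinomial_witness:
  "eval2 trinomial_witness x (1 + x) = x * (1 + x) * witness_cofactor x"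
proof -
  have "(1 + x) ^ 18 = (1 + x) * (1 + x) ^ 17" by (simp flip: power_Suc)
  moreover have "(1 + x) ^ 3 = (1 + x) * (1 + x) ^ 2" "x ^ 6 = x * x ^ 5" "x ^ 3 = x * x ^ 2"
    by (simp_all flip: power_Suc)
  ultimately show ?thesis
    by (simp add: eval2_def trinomial_witness_def poly_monom witness_cofactor_def algebra_simps)
qed

lemma witness_cofactor_root:
  assumes "a < b" "witness_cofactor a * witness_cofactor b < 0"
  obtains z where "a < z" "z < b" "witness_cofactor z = 0"
proof -
  have cont: "continuous_on {a..b} witness_cofactor"
    unfolding witness_cofactor_def by (intro continuous_intros)
  have "\<exists>z\<ge>a. z \<le> b \<and> witness_cofactor z = 0"
  proof (cases "witness_cofactor a < 0")
    case True
    then have "0 < witness_cofactor b" using assms(2) by (simp add: mult_less_0_iff)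
    then show ?thesis using IVT'[of witness_cofactor a 0 b] True assms(1) cont by auto
  next
    case False
    then have "0 < witness_cofactor a" "witness_cofactor b < 0"
      using assms(2) by (auto simp: mult_less_0_iff)
    then show ?thesis using IVT2'[of witness_cofactor b 0 a] assms(1) cont by auto
  qed
  then obtain z where z: "a \<le> z" "z \<le> b" "witness_cofactor z = 0" by blast
  moreover have "z \<noteq> a" "z \<noteq> b" using z(3) assms(2) by auto
  ultimately show thesis using that by force
qed

text \<open>The counts 4, 3 and 2 on the three intervals exhaust the bound nine. The term in x y^18
  has the lowest power of x and the highest total degree, as four roots in x > 0 demand of one
  term.\<close>

lemma eleven_le_card_zeros_witness:
  assumes "finite {x. x * (1 + x) * witness_cofactor x = 0}"
  shows "11 \<le> card {x. x * (1 + x) * witness_cofactor x = 0}"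
proof -
  note eval = witness_cofactor_def power_divide
  \<comment> \<open>The signs of the cofactor alternate along the endpoints from -10 to 1. At -3/5,
    1/5 and 6/25 its absolute value is below 10^-3, so these signs rest on exact rational
    evaluation.\<close>
  obtain z1 where z1: "-10 < z1" "z1 < -3" "witness_cofactor z1 = 0"
    by (rule witness_cofactor_root[of "-10" "-3"]) (simp_all add: eval)
  obtain z2 where z2: "-3 < z2" "z2 < -1" "witness_cofactor z2 = 0"
    by (rule witness_cofactor_root[of "-3" "-1"]) (simp_all add: eval)
  obtain z3 where z3: "-1 < z3" "z3 < -3/5" "witness_cofactor z3 = 0"
    by (rule witness_cofactor_root[of "-1" "-3/5"]) (simp_all add: eval)
  obtain z4 where z4: "-3/5 < z4" "z4 < -1/2" "witness_cofactor z4 = 0"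
    by (rule witness_cofactor_root[of "-3/5" "-1/2"]) (simp_all add: eval)
  obtain z5 where z5: "-1/2 < z5" "z5 < 0" "witness_cofactor z5 = 0"
    by (rule witness_cofactor_root[of "-1/2" 0]) (simp_all add: eval)
  obtain z6 where z6: "0 < z6" "z6 < 1/5" "witness_cofactor z6 = 0"
    by (rule witness_cofactor_root[of 0 "1/5"]) (simp_all add: eval)
  obtain z7 where z7: "1/5 < z7" "z7 < 6/25" "witness_cofactor z7 = 0"
    by (rule witness_cofactor_root[of "1/5" "6/25"]) (simp_all add: eval)
  obtain z8 where z8: "6/25 < z8" "z8 < 3/10" "witness_cofactor z8 = 0"
    by (rule witness_cofactor_root[of "6/25" "3/10"]) (simp_all add: eval)
  obtain z9 where z9: "3/10 < z9" "z9 < 1" "witness_cofactor z9 = 0"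
    by (rule witness_cofactor_root[of "3/10" 1]) (simp_all add: eval)
  let ?zs = "[z1, z2, -1, z3, z4, z5, 0, z6, z7, z8, z9]"
  have "sorted_wrt (<) ?zs" using z1 z2 z3 z4 z5 z6 z7 z8 z9 by simp
  then have "distinct ?zs" by (simp only: strict_sorted_iff)
  then have "card (set ?zs) = 11" using distinct_card[of ?zs] by simp
  moreover have "set ?zs \<subseteq> {x. x * (1 + x) * witness_cofactor x = 0}"
    using z1 z2 z3 z4 z5 z6 z7 z8 z9 by simp
  ultimately show ?thesis using card_mono[OF assms] by metis
qed

lemma finite_zeros_witness: "finite {x. x * (1 + x) * witness_cofactor x = 0}"
proof -
  define W :: "real poly" where "W = monom 1 2 + monom 29 5 * [:1, 1:] ^ 2 - smult (601 / 250000) ([:1, 1:] ^ 17)"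
  have W: "poly W x = witness_cofactor x" for x
    by (simp add: W_def witness_cofactor_def poly_monom)
  have "poly ([:0, 1:] * [:1, 1:] * W) 1 \<noteq> 0" by (simp add: W witness_cofactor_def)
  then have "[:0, 1:] * [:1, 1:] * W \<noteq> 0" by (metis poly_0)
  then have "finite {x. poly ([:0, 1:] * [:1, 1:] * W) x = 0}" by (rule poly_roots_finite)
  moreover have "poly ([:0, 1:] * [:1, 1:] * W) x = x * (1 + x) * witness_cofactor x" for x
    unfolding poly_mult W by simp
  ultimately show ?thesis by (simp only:)
qed

theorem theorem1p2:
  "(\<forall>(f :: real poly poly) (L :: (real \<times> real) set).
      num_terms2 f = 3 \<and> is_line L \<and> finite (L \<inter> real_curve f)
        \<longrightarrow> card (L \<inter> real_curve f) \<le> 11)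
   \<and> (\<exists>(f :: real poly poly) (L :: (real \<times> real) set).
      num_terms2 f = 3 \<and> is_line L \<and> finite (L \<inter> real_curve f)
        \<and> card (L \<inter> real_curve f) = 11)"
proof
  show "\<forall>(f :: real poly poly) (L :: (real \<times> real) set).
      num_terms2 f = 3 \<and> is_line L \<and> finite (L \<inter> real_curve f)
        \<longrightarrow> card (L \<inter> real_curve f) \<le> 11"
    using card_line_Int_trinomial_curve by blast
next
  let ?f = trinomial_witness and ?L = "range (\<lambda>t :: real. (t, 1 + t))"
  let ?Z = "{x. x * (1 + x) * witness_cofactor x = 0}"
  have terms: "num_terms2 ?f = 3" by (simp add: num_terms2_def monomials2_trinomial_witness)
  have line: "is_line ?L"
    unfolding is_line_iff by (intro exI[of _ 0] exI[of _ 1]) simp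
  have mem: "(t, 1 + t) \<in> real_curve ?f \<longleftrightarrow> t \<in> ?Z" for t
    by (simp only: real_curve_def mem_Collect_eq case_prod_conv eval2_trinomial_witness)
  have eq: "?L \<inter> real_curve ?f = (\<lambda>t. (t, 1 + t)) ` ?Z"
    using mem by blast
  have fin: "finite (?L \<inter> real_curve ?f)" unfolding eq using finite_zeros_witness by simp
  have "card (?L \<inter> real_curve ?f) = card ?Z"
    unfolding eq by (rule card_image) (simp add: inj_on_def)
  \<comment> \<open>Eleven roots have been exhibited; that there are no others is the upper bound
    applied to the witness itself.\<close>
  then have "card (?L \<inter> real_curve ?f) = 11"
    using eleven_le_card_zeros_witness[OF finite_zeros_witness]
      card_line_Int_trinomial_curve[OF terms line fin] by linarith
  then show "\<exists>(f :: real poly poly) (L :: (real \<times> real) set).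
      num_terms2 f = 3 \<and> is_line L \<and> finite (L \<inter> real_curve f)
        \<and> card (L \<inter> real_curve f) = 11"
    using terms line fin by blast
qed

end
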